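(* Let $X$ and $Y$ be $T_0$ spaces, and let $\mathbb{C}(X,Y)$ be the set of all continuous functions from $X$ to $Y$. Then the following two conditions are equivalent: (1) $Y$ is a sober space (resp., a $d$-space, a well-filtered space). (2) $\mathbb{C}(X,Y)$ equipped with the pointwise convergence topology is a sober space (resp., a $d$-space, a well-filtered space). That is, the equivalence holds for each of the three properties separately.
   Context: The specialization order of a $T_0$ space $X$ is $x\leq y$ iff $x\in\overline{\{y\}}$. A nonempty subset $A$ of a space is irreducible if whenever $A\subseteq F_1\cup F_2$ with $F_1,F_2$ closed, $A\subseteq F_1$ or $A\subseteq F_2$. A space $X$ is sober if every irreducible closed subset is $\overline{\{x\}}$ for a unique $x\in X$. A $T_0$ space $X$ is a $d$-space if $X$ with the specialization order is a dcpo (every directed subset has a supremum; directed sets are nonempty) and every open set of $X$ is Scott open in this order; equivalently, for every directed $D\subseteq X$ there is a point $x$ with $\overline{D}=\overline{\{x\}}$. A $T_0$ space $X$ is well-filtered if for every open set $U$ and every family $\mathcal K$ of nonempty compact saturated subsets of $X$ that is filtered (nonempty, and any two members contain a common third member), $\bigcap\mathcal K\subseteq U$ implies $K\subseteq U$ for some $K\in\mathcal K$; here saturated means being an upper set in the specialization order. The pointwise convergence topology on $\mathbb{C}(X,Y)$ has as a subbasis the sets $S(x,U)=\{f\in\mathbb{C}(X,Y): f(x)\in U\}$, with $x\in X$ and $U$ open in $Y$.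
   Formalization: The space X is assumed to be nonempty; for empty X the function space is a single point, so (2) holds for every Y and the implication from (2) to (1) fails when Y lacks the property. *)

theory Defs
  imports "HOL-Analysis.Analysis"
begin

section \<open>The specialization order\<close>

(* For y outside topspace X the closure of {y} is empty, so spec_le X x y
   forces both x and y to be points of X. *)
definition spec_le :: "'a topology \<Rightarrow> 'a \<Rightarrow> 'a \<Rightarrow> bool" where
  "spec_le X x y \<longleftrightarrow> x \<in> X closure_of {y}"

lemma spec_le_imp_topspace:
  "spec_le X x y \<Longrightarrow> x \<in> topspace X \<and> y \<in> topspace X"
  by (auto simp: spec_le_def in_closure_of)

definition spec_upper :: "'a topology \<Rightarrow> 'a set \<Rightarrow> bool" where
  "spec_upper X A \<longleftrightarrow> A \<subseteq> topspace X \<and> (\<forall>x\<in>A. \<forall>y. spec_le X x y \<longrightarrow> y \<in> A)"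

definition spec_directed :: "'a topology \<Rightarrow> 'a set \<Rightarrow> bool" where
  "spec_directed X D \<longleftrightarrow>
     D \<subseteq> topspace X \<and> D \<noteq> {} \<and>
     (\<forall>x\<in>D. \<forall>y\<in>D. \<exists>z\<in>D. spec_le X x z \<and> spec_le X y z)"

definition spec_sup :: "'a topology \<Rightarrow> 'a set \<Rightarrow> 'a \<Rightarrow> bool" where
  "spec_sup X D s \<longleftrightarrow>
     s \<in> topspace X \<and> (\<forall>x\<in>D. spec_le X x s) \<and>
     (\<forall>u\<in>topspace X. (\<forall>x\<in>D. spec_le X x u) \<longrightarrow> spec_le X s u)"

definition scott_open :: "'a topology \<Rightarrow> 'a set \<Rightarrow> bool" where
  "scott_open X U \<longleftrightarrow>
     spec_upper X U \<and>
     (\<forall>D s. spec_directed X D \<and> spec_sup X D s \<and> s \<in> U \<longrightarrow> D \<inter> U \<noteq> {})"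

section \<open>Sober spaces, d-spaces and well-filtered spaces\<close>

definition irreducible_in :: "'a topology \<Rightarrow> 'a set \<Rightarrow> bool" where
  "irreducible_in X A \<longleftrightarrow>
     A \<subseteq> topspace X \<and> A \<noteq> {} \<and>
     (\<forall>F1 F2. closedin X F1 \<and> closedin X F2 \<and> A \<subseteq> F1 \<union> F2 \<longrightarrow> A \<subseteq> F1 \<or> A \<subseteq> F2)"

definition sober_space :: "'a topology \<Rightarrow> bool" where
  "sober_space X \<longleftrightarrow>
     (\<forall>A. closedin X A \<and> irreducible_in X A \<longrightarrow>
        (\<exists>!x. x \<in> topspace X \<and> A = X closure_of {x}))"

definition d_space :: "'a topology \<Rightarrow> bool" where
  "d_space X \<longleftrightarrow>
     t0_space X \<and>
     (\<forall>D. spec_directed X D \<longrightarrow> (\<exists>s. spec_sup X D s)) \<and>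
     (\<forall>U. openin X U \<longrightarrow> scott_open X U)"

definition well_filtered_space :: "'a topology \<Rightarrow> bool" where
  "well_filtered_space X \<longleftrightarrow>
     t0_space X \<and>
     (\<forall>U \<K>. openin X U \<and>
        (\<forall>K\<in>\<K>. K \<noteq> {} \<and> compactin X K \<and> spec_upper X K) \<and>
        \<K> \<noteq> {} \<and> (\<forall>K1\<in>\<K>. \<forall>K2\<in>\<K>. \<exists>K3\<in>\<K>. K3 \<subseteq> K1 \<inter> K2) \<and>
        \<Inter>\<K> \<subseteq> U \<longrightarrow>
        (\<exists>K\<in>\<K>. K \<subseteq> U))"

section \<open>Function spaces\<close>

(* Continuity depends only on the values on topspace X; requiring functions to be
   extensional (undefined off topspace X) gives each continuous map X \<rightarrow> Y
   exactly one representative. *)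
definition cont_maps :: "'a topology \<Rightarrow> 'b topology \<Rightarrow> ('a \<Rightarrow> 'b) set" where
  "cont_maps X Y = {f \<in> extensional (topspace X). continuous_map X Y f}"

definition pointwise_topology :: "'a topology \<Rightarrow> 'b topology \<Rightarrow> ('a \<Rightarrow> 'b) topology" where
  "pointwise_topology X Y =
     topology (arbitrary union_of
       (finite intersection_of
          (\<lambda>S. \<exists>x U. x \<in> topspace X \<and> openin Y U \<and> S = {f \<in> cont_maps X Y. f x \<in> U})
        relative_to cont_maps X Y))"

lemma topspace_pointwise_topology [simp]:
  "topspace (pointwise_topology X Y) = cont_maps X Y"
  by (simp add: pointwise_topology_def)

end

theory Submission
  imports Defs
begin

text \<open>All three properties say that certain irreducible sets have generic points. An irreducible
  set of functions has a generic point as soon as each of its evaluations has one: the pointwise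
  choice of these points is automatically continuous, and irreducibility passes from subbasic to
  arbitrary open sets. For well-filteredness the irreducible set is the complement of a maximal
  open set that contains the given open set but no member of the filtered family (topological
  Rudin lemma). Conversely, all three properties pass to retracts, and \<open>Y\<close> is a retract of the
  function space by way of constant maps and evaluation at a point.\<close>

section \<open>Generic points\<close>

text \<open>For \<open>A\<close> inside the space this means that \<open>A\<close> and
  \<open>{s}\<close> have the same closure. Testing with open sets lets the notion apply to sets
  that are not closed and turns transport along continuous maps into taking preimages.\<close>

definition generic_point :: "'a topology \<Rightarrow> 'a set \<Rightarrow> 'a \<Rightarrow> bool" where
  "generic_point X A s \<longleftrightarrow>
     s \<in> topspace X \<and> (\<forall>U. openin X U \<longrightarrow> (s \<in> U \<longleftrightarrow> A \<inter> U \<noteq> {}))"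

lemma spec_le_iff:
  "spec_le X x y \<longleftrightarrow>
     x \<in> topspace X \<and> y \<in> topspace X \<and> (\<forall>U. openin X U \<and> x \<in> U \<longrightarrow> y \<in> U)"
  unfolding spec_le_def in_closure_of by auto

lemma spec_le_refl: "x \<in> topspace X \<Longrightarrow> spec_le X x x"
  by (simp add: spec_le_iff)

lemma spec_le_trans: "spec_le X x y \<Longrightarrow> spec_le X y z \<Longrightarrow> spec_le X x z"
  by (simp add: spec_le_iff)

lemma spec_le_image:
  assumes "continuous_map X Y f" "spec_le X x y"
  shows "spec_le Y (f x) (f y)"
  using assms unfolding spec_le_def
  by (metis continuous_map_image_closure_subset image_empty image_insert image_subset_iff)

lemma t0_space_spec_le_antisym:
  "t0_space X \<Longrightarrow> spec_le X x y \<Longrightarrow> spec_le X y x \<Longrightarrow> x = y"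
  unfolding t0_space_def spec_le_iff by metis

lemma t0_space_generic_point_unique:
  "t0_space X \<Longrightarrow> generic_point X A s \<Longrightarrow> generic_point X A t \<Longrightarrow> s = t"
  unfolding t0_space_def generic_point_def by metis

text \<open>Two subsets have the same closure exactly when they meet the same open sets.\<close>

lemma generic_point_iff_closure_of:
  assumes "A \<subseteq> topspace X"
  shows "generic_point X A s \<longleftrightarrow> s \<in> topspace X \<and> X closure_of A = X closure_of {s}"
proof (intro iffI conjI)
  assume "generic_point X A s"
  then show "s \<in> topspace X" "X closure_of A = X closure_of {s}"
    unfolding generic_point_def closure_of_def by auto
next
  assume s: "s \<in> topspace X \<and> X closure_of A = X closure_of {s}"
  have "A \<inter> U \<noteq> {} \<longleftrightarrow> {s} \<inter> U \<noteq> {}" if "openin X U" for U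
    using s openin_Int_closure_of_eq_empty[OF that, of A]
      openin_Int_closure_of_eq_empty[OF that, of "{s}"] by (metis Int_commute)
  then show "generic_point X A s"
    using s by (simp add: generic_point_def)
qed

lemma generic_point_image:
  assumes "continuous_map X Y f" "A \<subseteq> topspace X" "generic_point X A s"
  shows "generic_point Y (f ` A) (f s)"
  unfolding generic_point_def
proof (intro conjI allI impI)
  show "f s \<in> topspace Y"
    using assms by (auto simp: generic_point_def continuous_map_def)
  fix U assume "openin Y U"
  then have "openin X {x \<in> topspace X. f x \<in> U}"
    using assms(1) by (rule openin_continuous_map_preimage[rotated])
  then show "f s \<in> U \<longleftrightarrow> f ` A \<inter> U \<noteq> {}"
    using assms(2,3) unfolding generic_point_def by blast
qed

section \<open>Irreducible and directed sets\<close>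

text \<open>Complementation turns closed covers into open sets with nonempty trace on
  \<open>A\<close>. This form is the one that continuous preimages and finite intersections
  respect.\<close>

lemma irreducible_in_iff_open:
  "irreducible_in X A \<longleftrightarrow>
     A \<subseteq> topspace X \<and> A \<noteq> {} \<and>
     (\<forall>U V. openin X U \<and> openin X V \<and> A \<inter> U \<noteq> {} \<and> A \<inter> V \<noteq> {} \<longrightarrow> A \<inter> (U \<inter> V) \<noteq> {})"
  (is "?L \<longleftrightarrow> ?R")
proof
  assume L: ?L
  show ?R
  proof (intro conjI allI impI)
    fix U V assume UV: "openin X U \<and> openin X V \<and> A \<inter> U \<noteq> {} \<and> A \<inter> V \<noteq> {}"
    then have "closedin X (topspace X - U)" "closedin X (topspace X - V)"
      by auto
    moreover have "\<not> A \<subseteq> topspace X - U" "\<not> A \<subseteq> topspace X - V"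
      using UV by auto
    ultimately have "\<not> A \<subseteq> (topspace X - U) \<union> (topspace X - V)"
      using L unfolding irreducible_in_def by blast
    then show "A \<inter> (U \<inter> V) \<noteq> {}"
      using L by (auto simp: irreducible_in_def)
  qed (use L in \<open>auto simp: irreducible_in_def\<close>)
next
  assume R: ?R
  show ?L
    unfolding irreducible_in_def
  proof (intro conjI allI impI)
    fix F G assume FG: "closedin X F \<and> closedin X G \<and> A \<subseteq> F \<union> G"
    then have "openin X (topspace X - F)" "openin X (topspace X - G)"
      by auto
    moreover have "A \<inter> ((topspace X - F) \<inter> (topspace X - G)) = {}"
      using FG by blast
    ultimately have "A \<inter> (topspace X - F) = {} \<or> A \<inter> (topspace X - G) = {}"
      using R by blast
    then show "A \<subseteq> F \<or> A \<subseteq> G"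
      using R by blast
  qed (use R in auto)
qed

lemma irreducible_in_meets_Inter:
  assumes "irreducible_in X A" "finite \<F>" "\<And>U. U \<in> \<F> \<Longrightarrow> openin X U \<and> A \<inter> U \<noteq> {}"
  shows "A \<inter> \<Inter>\<F> \<noteq> {}"
proof -
  \<comment> \<open>The induction carries an open set inside the intersection, because
    \<open>\<Inter>{}\<close> is \<open>UNIV\<close>, which need not be open in \<open>X\<close>;
    the empty family is served by \<open>topspace X\<close>.\<close>
  have "\<exists>W. openin X W \<and> W \<subseteq> \<Inter>\<F> \<and> A \<inter> W \<noteq> {}"
    using assms(2,3)
  proof (induction \<F>)
    case empty
    show ?case
      using assms(1) by (auto simp: irreducible_in_def intro!: exI[of _ "topspace X"])
  next
    case (insert U \<F>)
    then obtain W where W: "openin X W" "W \<subseteq> \<Inter>\<F>" "A \<inter> W \<noteq> {}"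
      by auto
    have "A \<inter> (U \<inter> W) \<noteq> {}"
      using assms(1) insert.prems W unfolding irreducible_in_iff_open by simp
    then show ?case
      using W insert.prems by (intro exI[of _ "U \<inter> W"]) auto
  qed
  then show ?thesis
    by blast
qed

lemma irreducible_in_image:
  assumes f: "continuous_map X Y f" and A: "irreducible_in X A"
  shows "irreducible_in Y (f ` A)"
  unfolding irreducible_in_iff_open
proof (intro conjI allI impI)
  have AX: "A \<subseteq> topspace X"
    using A by (simp add: irreducible_in_def)
  then show "f ` A \<subseteq> topspace Y"
    using f by (auto simp: continuous_map_def)
  show "f ` A \<noteq> {}"
    using A by (simp add: irreducible_in_def)
  fix U V assume UV: "openin Y U \<and> openin Y V \<and> f ` A \<inter> U \<noteq> {} \<and> f ` A \<inter> V \<noteq> {}"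
  let ?P = "\<lambda>W. {x \<in> topspace X. f x \<in> W}"
  have "openin X (?P U)" "openin X (?P V)"
    using UV f by (auto intro: openin_continuous_map_preimage)
  moreover have "A \<inter> ?P U \<noteq> {}" "A \<inter> ?P V \<noteq> {}"
    using UV AX by blast+
  ultimately have "A \<inter> (?P U \<inter> ?P V) \<noteq> {}"
    using A unfolding irreducible_in_iff_open by blast
  then show "f ` A \<inter> (U \<inter> V) \<noteq> {}"
    by blast
qed

lemma irreducible_in_closure_of:
  assumes "irreducible_in X A"
  shows "irreducible_in X (X closure_of A)"
proof -
  have AX: "A \<subseteq> topspace X"
    using assms by (simp add: irreducible_in_def)
  have "(X closure_of A) \<inter> U \<noteq> {} \<longleftrightarrow> A \<inter> U \<noteq> {}" if "openin X U" for U
    using openin_Int_closure_of_eq_empty[OF that] by (metis Int_commute)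
  then show ?thesis
    using assms AX closure_of_subset_topspace[of X A] closure_of_subset[OF AX]
    unfolding irreducible_in_iff_open by (metis openin_Int subset_empty)
qed

text \<open>Open sets are upper sets, so an upper bound in \<open>D\<close> of a point of
  \<open>U\<close> and a point of \<open>V\<close> lies in both.\<close>

lemma spec_directed_imp_irreducible:
  assumes "spec_directed X D"
  shows "irreducible_in X D"
  unfolding irreducible_in_iff_open
proof (intro conjI allI impI)
  fix U V assume "openin X U \<and> openin X V \<and> D \<inter> U \<noteq> {} \<and> D \<inter> V \<noteq> {}"
  then obtain x y where xy: "openin X U" "openin X V" "x \<in> D" "y \<in> D" "x \<in> U" "y \<in> V"
    by blast
  then obtain z where "z \<in> D" "spec_le X x z" "spec_le X y z"
    using assms unfolding spec_directed_def by blast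
  then show "D \<inter> (U \<inter> V) \<noteq> {}"
    using xy unfolding spec_le_iff by blast
qed (use assms in \<open>auto simp: spec_directed_def\<close>)

lemma spec_directed_image:
  assumes f: "continuous_map X Y f" and D: "spec_directed X D"
  shows "spec_directed Y (f ` D)"
  unfolding spec_directed_def
proof (intro conjI)
  show "f ` D \<subseteq> topspace Y"
    using f D by (auto simp: continuous_map_def spec_directed_def)
  show "f ` D \<noteq> {}"
    using D by (simp add: spec_directed_def)
  show "\<forall>x\<in>f ` D. \<forall>y\<in>f ` D. \<exists>z\<in>f ` D. spec_le Y x z \<and> spec_le Y y z"
    using D spec_le_image[OF f] unfolding spec_directed_def by blast
qed

text \<open>Passing to the closure preserves irreducibility and the generic points, so closed sets
  suffice; the T0 axiom supplies uniqueness.\<close>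

lemma sober_space_iff_generic_point:
  assumes "t0_space X"
  shows "sober_space X \<longleftrightarrow> (\<forall>A. irreducible_in X A \<longrightarrow> (\<exists>s. generic_point X A s))"
    (is "?L \<longleftrightarrow> ?R")
proof
  assume L: ?L
  show ?R
  proof (intro allI impI)
    fix A assume A: "irreducible_in X A"
    then have "\<exists>s. s \<in> topspace X \<and> X closure_of A = X closure_of {s}"
      using L irreducible_in_closure_of[OF A] unfolding sober_space_def
      by (metis closedin_closure_of)
    then show "\<exists>s. generic_point X A s"
      using A by (simp add: generic_point_iff_closure_of irreducible_in_def)
  qed
next
  assume R: ?R
  show ?L
    unfolding sober_space_def
  proof (intro allI impI)
    fix A assume A: "closedin X A \<and> irreducible_in X A"
    then have "generic_point X A s \<longleftrightarrow> s \<in> topspace X \<and> A = X closure_of {s}" for s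
      by (simp add: generic_point_iff_closure_of closedin_subset closure_of_closedin)
    then show "\<exists>!s. s \<in> topspace X \<and> A = X closure_of {s}"
      using R A t0_space_generic_point_unique[OF assms] by metis
  qed
qed

lemma generic_point_imp_spec_sup:
  assumes "generic_point X D s" "D \<subseteq> topspace X"
  shows "spec_sup X D s"
  using assms unfolding generic_point_def spec_sup_def spec_le_iff by blast

text \<open>A supremum lies in every open set that meets \<open>D\<close>, and Scott openness is the
  converse implication. In the other direction a generic point is a supremum, and by T0 it is the
  only one.\<close>

lemma d_space_iff_generic_point:
  assumes "t0_space X"
  shows "d_space X \<longleftrightarrow> (\<forall>D. spec_directed X D \<longrightarrow> (\<exists>s. generic_point X D s))"
    (is "?L \<longleftrightarrow> ?R")
proof
  assume L: ?L
  show ?R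
  proof (intro allI impI)
    fix D assume D: "spec_directed X D"
    then obtain s where s: "spec_sup X D s"
      using L unfolding d_space_def by blast
    have "s \<in> U \<longleftrightarrow> D \<inter> U \<noteq> {}" if U: "openin X U" for U
    proof
      assume "s \<in> U"
      then show "D \<inter> U \<noteq> {}"
        using L U D s unfolding d_space_def scott_open_def by blast
    next
      assume "D \<inter> U \<noteq> {}"
      then show "s \<in> U"
        using s U unfolding spec_sup_def spec_le_iff by blast
    qed
    then have "generic_point X D s"
      using s by (simp add: generic_point_def spec_sup_def)
    then show "\<exists>s. generic_point X D s" ..
  qed
next
  assume R: ?R
  have "scott_open X U" if U: "openin X U" for U
    unfolding scott_open_def
  proof (intro conjI allI impI)
    show "spec_upper X U"
      using U openin_subset[OF U] by (auto simp: spec_upper_def spec_le_iff)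
    fix D s assume D: "spec_directed X D \<and> spec_sup X D s \<and> s \<in> U"
    then obtain t where t: "generic_point X D t"
      using R by blast
    then have "spec_sup X D t"
      using D by (simp add: generic_point_imp_spec_sup spec_directed_def)
    then have "s = t"
      using D assms by (intro t0_space_spec_le_antisym) (auto simp: spec_sup_def)
    then show "D \<inter> U \<noteq> {}"
      using t D U by (simp add: generic_point_def)
  qed
  then show ?L
    unfolding d_space_def
    using R assms generic_point_imp_spec_sup by (metis spec_directed_def)
qed

section \<open>Filtered families of compact saturated sets\<close>

text \<open>This is the saturation of \<open>S\<close>. It is needed because continuous images of
  compact saturated sets are compact but need not be saturated.\<close>

definition spec_up_closure :: "'a topology \<Rightarrow> 'a set \<Rightarrow> 'a set" where
  "spec_up_closure X S = {y. \<exists>x\<in>S. spec_le X x y}"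

lemma spec_up_closure_subset_topspace: "spec_up_closure X S \<subseteq> topspace X"
  unfolding spec_up_closure_def using spec_le_imp_topspace by fast

lemma spec_upper_up_closure: "spec_upper X (spec_up_closure X S)"
  unfolding spec_upper_def spec_up_closure_def
  using spec_le_trans spec_le_imp_topspace by fast

lemma spec_up_closure_superset: "S \<subseteq> topspace X \<Longrightarrow> S \<subseteq> spec_up_closure X S"
  unfolding spec_up_closure_def using spec_le_refl by fast

lemma spec_up_closure_subset_open:
  "openin X U \<Longrightarrow> S \<subseteq> U \<Longrightarrow> spec_up_closure X S \<subseteq> U"
  unfolding spec_up_closure_def spec_le_iff by blast

text \<open>An open set containing \<open>S\<close> already contains its saturation, so a finite
  subcover of \<open>S\<close> also covers the saturation.\<close>

lemma compactin_spec_up_closure: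
  assumes "compactin X S"
  shows "compactin X (spec_up_closure X S)"
  unfolding compactin_def
proof (intro conjI allI impI)
  show "spec_up_closure X S \<subseteq> topspace X"
    by (rule spec_up_closure_subset_topspace)
  fix \<U> assume \<U>: "(\<forall>U\<in>\<U>. openin X U) \<and> spec_up_closure X S \<subseteq> \<Union>\<U>"
  moreover have "S \<subseteq> spec_up_closure X S"
    using assms by (simp add: spec_up_closure_superset compactin_subset_topspace)
  ultimately obtain \<F> where \<F>: "finite \<F>" "\<F> \<subseteq> \<U>" "S \<subseteq> \<Union>\<F>"
    using assms unfolding compactin_def by (meson order_trans)
  moreover have "openin X (\<Union>\<F>)"
    using \<U> \<F>(2) by (intro openin_Union) blast
  ultimately show "\<exists>\<F>. finite \<F> \<and> \<F> \<subseteq> \<U> \<and> spec_up_closure X S \<subseteq> \<Union>\<F>"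
    using spec_up_closure_subset_open by metis
qed

definition filtered_family :: "'a set set \<Rightarrow> bool" where
  "filtered_family \<K> \<longleftrightarrow> \<K> \<noteq> {} \<and> (\<forall>K1\<in>\<K>. \<forall>K2\<in>\<K>. \<exists>K3\<in>\<K>. K3 \<subseteq> K1 \<inter> K2)"

text \<open>Well-filteredness for compact sets \<open>f K\<close> that need not be saturated: the
  saturations are compact, and monotonicity of \<open>f\<close> keeps them filtered. It is meant for
  images of the members of a filtered family in another space.\<close>

lemma well_filtered_spaceD:
  assumes X: "well_filtered_space X" and "openin X U"
    and \<K>: "filtered_family \<K>"
    and comp: "\<And>K. K \<in> \<K> \<Longrightarrow> compactin X (f K) \<and> f K \<noteq> {}"
    and mono: "\<And>K L. K \<in> \<K> \<Longrightarrow> L \<in> \<K> \<Longrightarrow> K \<subseteq> L \<Longrightarrow> f K \<subseteq> f L"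
    and sub: "(\<Inter>K\<in>\<K>. spec_up_closure X (f K)) \<subseteq> U"
  shows "\<exists>K\<in>\<K>. f K \<subseteq> U"
proof -
  let ?g = "\<lambda>K. spec_up_closure X (f K)"
  have fg: "f K \<subseteq> ?g K" if "K \<in> \<K>" for K
    using comp[OF that] by (simp add: spec_up_closure_superset compactin_subset_topspace)
  have gmono: "?g K \<subseteq> ?g L" if "K \<in> \<K>" "L \<in> \<K>" "K \<subseteq> L" for K L
    using mono[OF that] unfolding spec_up_closure_def by blast
  have filt: "\<exists>K3\<in>?g ` \<K>. K3 \<subseteq> K1 \<inter> K2" if K12: "K1 \<in> ?g ` \<K>" "K2 \<in> ?g ` \<K>" for K1 K2
  proof -
    obtain L1 L2 where L: "L1 \<in> \<K>" "L2 \<in> \<K>" "K1 = ?g L1" "K2 = ?g L2"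
      using K12 by blast
    then obtain L3 where "L3 \<in> \<K>" "L3 \<subseteq> L1 \<inter> L2"
      using \<K> unfolding filtered_family_def by blast
    then show ?thesis
      using L gmono[of L3 L1] gmono[of L3 L2] by blast
  qed
  have "\<exists>K\<in>?g ` \<K>. K \<subseteq> U"
  proof (rule conjunct2[OF X[unfolded well_filtered_space_def], rule_format], intro conjI ballI)
    fix K assume "K \<in> ?g ` \<K>"
    then show "K \<noteq> {}" "compactin X K" "spec_upper X K"
      using comp fg by (auto simp: compactin_spec_up_closure spec_upper_up_closure)
  qed (use \<open>openin X U\<close> sub \<K> filt in \<open>simp_all add: filtered_family_def\<close>)
  then show ?thesis
    using fg by blast
qed

text \<open>Zorn's lemma applies to the open sets that contain \<open>U\<close> but no member of
  \<open>\<K>\<close>: a compact set covered by the union of a chain is already contained in one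
  member of the chain.\<close>

lemma Rudin_maximal_open:
  assumes U: "openin X U" and \<K>: "\<And>K. K \<in> \<K> \<Longrightarrow> compactin X K \<and> \<not> K \<subseteq> U"
  obtains V where "openin X V" "U \<subseteq> V" "\<And>K. K \<in> \<K> \<Longrightarrow> \<not> K \<subseteq> V"
    "\<And>W. openin X W \<Longrightarrow> V \<subset> W \<Longrightarrow> \<exists>K\<in>\<K>. K \<subseteq> W"
proof -
  define \<A> where "\<A> = {V. openin X V \<and> U \<subseteq> V \<and> (\<forall>K\<in>\<K>. \<not> K \<subseteq> V)}"
  have "\<exists>M\<in>\<A>. \<forall>W\<in>\<A>. M \<subseteq> W \<longrightarrow> W = M"
  proof (rule subset_Zorn_nonempty)
    show "\<A> \<noteq> {}"
      using U \<K> by (auto simp: \<A>_def)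
    fix \<C> assume \<C>: "\<C> \<noteq> {}" "subset.chain \<A> \<C>"
    then have CA: "\<C> \<subseteq> \<A>"
      by (simp add: subset_chain_def)
    have "\<not> K \<subseteq> \<Union>\<C>" if K: "K \<in> \<K>" for K
    proof
      assume "K \<subseteq> \<Union>\<C>"
      then obtain \<F> where \<F>: "finite \<F>" "\<F> \<subseteq> \<C>" "K \<subseteq> \<Union>\<F>"
        using \<K>[OF K] CA unfolding compactin_def \<A>_def by blast
      \<comment> \<open>A finite nonempty chain has a largest member, which is its union. Here
        \<open>\<F>\<close> is nonempty because \<open>K\<close>, not being contained in
        \<open>U\<close>, has a point.\<close>
      moreover have "\<Union>\<F> \<in> \<F>"
      proof (rule Union_in_chain[OF \<F>(1)])
        show "\<F> \<noteq> {}"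
          using \<F>(3) \<K>[OF K] by (metis Union_empty empty_subsetI subset_empty)
        show "subset.chain \<A> \<F>"
          using \<C>(2) \<F>(2) unfolding subset_chain_def by (meson subset_iff)
      qed
      ultimately show False
        using CA K unfolding \<A>_def by blast
    qed
    then show "\<Union>\<C> \<in> \<A>"
      using CA \<C>(1) by (auto simp: \<A>_def)
  qed
  then obtain V where V: "V \<in> \<A>" "\<And>W. W \<in> \<A> \<Longrightarrow> V \<subseteq> W \<Longrightarrow> W = V"
    by metis
  show thesis
  proof
    show "\<exists>K\<in>\<K>. K \<subseteq> W" if "openin X W" "V \<subset> W" for W
    proof (rule ccontr)
      assume "\<not> (\<exists>K\<in>\<K>. K \<subseteq> W)"
      then have "W \<in> \<A>"
        using that V(1) by (auto simp: \<A>_def)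
      then show False
        using that(2) V(2)[of W] by auto
    qed
  qed (use V(1) in \<open>auto simp: \<A>_def\<close>)
qed

section \<open>The function space\<close>

lemma openin_pointwise_subbasic:
  assumes "x \<in> topspace X" "openin Y U"
  shows "openin (pointwise_topology X Y) {f \<in> cont_maps X Y. f x \<in> U}"
proof -
  let ?P = "\<lambda>S. \<exists>x U. x \<in> topspace X \<and> openin Y U \<and> S = {f \<in> cont_maps X Y. f x \<in> U}"
  have "?P {f \<in> cont_maps X Y. f x \<in> U}"
    using assms by blast
  then have "(finite intersection_of ?P relative_to cont_maps X Y)
      (cont_maps X Y \<inter> {f \<in> cont_maps X Y. f x \<in> U})"
    by (intro relative_to_inc finite_intersection_of_inc)
  then show ?thesis
    unfolding pointwise_topology_def openin_subbase
    by (intro arbitrary_union_of_inc) (simp add: Int_absorb1 Collect_restrict)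
qed

text \<open>The factor \<open>T\<close> in \<open>T \<inter> \<Inter>\<F> \<subseteq> W\<close>
  covers the case of an empty \<open>\<F>\<close>, where \<open>\<Inter>\<F>\<close> is
  \<open>UNIV\<close>.\<close>

lemma openin_subbase_nbhd:
  assumes "openin (topology (arbitrary union_of (finite intersection_of P relative_to T))) W"
    and "g \<in> W"
  obtains \<F> where "finite \<F>" "g \<in> \<Inter>\<F>" "T \<inter> \<Inter>\<F> \<subseteq> W" "\<And>S. S \<in> \<F> \<Longrightarrow> P S"
proof -
  obtain B where B: "g \<in> B" "B \<subseteq> W" "(finite intersection_of P relative_to T) B"
    using assms(2) assms(1)[unfolded openin_subbase] by (auto simp: union_of_def)
  then obtain \<F> where "finite \<F>" "\<F> \<subseteq> Collect P" "T \<inter> \<Inter>\<F> = B"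
    unfolding intersection_of_def relative_to_def by auto
  with B that show thesis
    by (metis IntE equalityD1 mem_Collect_eq subset_iff)
qed

lemma openin_pointwise_nbhd:
  assumes "openin (pointwise_topology X Y) W" "g \<in> W"
  obtains \<F> where "finite \<F>" "g \<in> \<Inter>\<F>" "cont_maps X Y \<inter> \<Inter>\<F> \<subseteq> W"
    "\<And>S. S \<in> \<F> \<Longrightarrow> \<exists>x U. x \<in> topspace X \<and> openin Y U \<and> S = {f \<in> cont_maps X Y. f x \<in> U}"
proof -
  show thesis
    by (rule openin_subbase_nbhd[OF assms(1)[unfolded pointwise_topology_def] assms(2)])
      (rule that)
qed

lemma continuous_map_pointwise_eval:
  assumes "x \<in> topspace X"
  shows "continuous_map (pointwise_topology X Y) Y (\<lambda>f. f x)"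
  using assms openin_pointwise_subbasic
  by (auto simp: continuous_map_def cont_maps_def Pi_iff)

lemma continuous_map_pointwise_const:
  "continuous_map Y (pointwise_topology X Y) (\<lambda>y. restrict (\<lambda>x. y) (topspace X))"
proof -
  have *: "restrict (\<lambda>x. y) (topspace X) \<in> cont_maps X Y" if "y \<in> topspace Y" for y
    using that by (simp add: cont_maps_def continuous_map_eq[OF continuous_map_const[THEN iffD2]])
  show ?thesis
    unfolding pointwise_topology_def
  proof (rule continuous_map_into_topology_subbase)
    fix S assume "\<exists>x U. x \<in> topspace X \<and> openin Y U \<and> S = {f \<in> cont_maps X Y. f x \<in> U}"
    then obtain x U where S: "x \<in> topspace X" "openin Y U" "S = {f \<in> cont_maps X Y. f x \<in> U}"
      by blast
    then have "{y \<in> topspace Y. restrict (\<lambda>x. y) (topspace X) \<in> S} = U"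
      using * openin_subset[OF S(2)] by auto
    then show "openin Y {y \<in> topspace Y. restrict (\<lambda>x. y) (topspace X) \<in> S}"
      using S by simp
  qed (use * in auto)
qed

lemma t0_space_pointwise:
  assumes "t0_space Y"
  shows "t0_space (pointwise_topology X Y)"
  unfolding t0_space_def
proof (intro ballI impI allI)
  fix f g assume fg: "f \<in> topspace (pointwise_topology X Y)"
    "g \<in> topspace (pointwise_topology X Y)" "f \<noteq> g"
  \<comment> \<open>Members of \<open>cont_maps\<close> agree off \<open>topspace X\<close>, so
    distinct ones differ at a point of \<open>X\<close>.\<close>
  then obtain x where x: "x \<in> topspace X" "f x \<noteq> g x"
    unfolding topspace_pointwise_topology cont_maps_def
    by (metis (lifting) extensionalityI mem_Collect_eq)
  then have "f x \<in> topspace Y" "g x \<in> topspace Y"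
    using fg by (auto simp: cont_maps_def continuous_map_def)
  then obtain U where "openin Y U" "f x \<notin> U \<longleftrightarrow> g x \<in> U"
    using assms x unfolding t0_space_def by blast
  then show "\<exists>U. openin (pointwise_topology X Y) U \<and> (f \<notin> U \<longleftrightarrow> g \<in> U)"
    using fg openin_pointwise_subbasic[OF x(1)]
    by (intro exI[of _ "{f \<in> cont_maps X Y. f x \<in> U}"]) auto
qed

text \<open>The preimage of an open set under the pointwise choice \<open>g\<close> is the union of
  its preimages under the members of \<open>A\<close>, so \<open>g\<close> is continuous. On
  subbasic sets genericity is that of the evaluations; irreducibility extends it to finite
  intersections.\<close>

lemma generic_point_pointwise:
  assumes A: "irreducible_in (pointwise_topology X Y) A"
    and gen: "\<And>x. x \<in> topspace X \<Longrightarrow> \<exists>y. generic_point Y ((\<lambda>f. f x) ` A) y"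
  shows "\<exists>g. generic_point (pointwise_topology X Y) A g"
proof -
  let ?C = "pointwise_topology X Y"
  have AC: "A \<subseteq> cont_maps X Y"
    using A by (simp add: irreducible_in_def)
  obtain h where h: "\<And>x. x \<in> topspace X \<Longrightarrow> generic_point Y ((\<lambda>f. f x) ` A) (h x)"
    using gen by metis
  \<comment> \<open>Restricting makes \<open>g\<close> extensional, as membership in
    \<open>cont_maps\<close> demands.\<close>
  define g where "g = restrict h (topspace X)"
  have mem: "g x \<in> V \<longleftrightarrow> (\<exists>f\<in>A. f x \<in> V)" if "x \<in> topspace X" "openin Y V" for x V
    using h that unfolding generic_point_def g_def by auto
  have "continuous_map X Y g"
    unfolding continuous_map_def
  proof (intro conjI allI impI)
    show "g \<in> topspace X \<rightarrow> topspace Y"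
      using h by (auto simp: g_def generic_point_def)
    fix V assume V: "openin Y V"
    have "{x \<in> topspace X. g x \<in> V} = (\<Union>f\<in>A. {x \<in> topspace X. f x \<in> V})"
      using mem V by auto
    also have "openin X \<dots>"
      using AC V by (auto simp: cont_maps_def continuous_map_def)
    finally show "openin X {x \<in> topspace X. g x \<in> V}" .
  qed
  then have gC: "g \<in> cont_maps X Y"
    by (simp add: cont_maps_def g_def)
  have "g \<in> W \<longleftrightarrow> A \<inter> W \<noteq> {}" if W: "openin ?C W" for W
  proof
    assume gW: "g \<in> W"
    obtain \<F> where \<F>: "finite \<F>" "g \<in> \<Inter>\<F>" "cont_maps X Y \<inter> \<Inter>\<F> \<subseteq> W"
      "\<And>S. S \<in> \<F> \<Longrightarrow> \<exists>x U. x \<in> topspace X \<and> openin Y U \<and> S = {f \<in> cont_maps X Y. f x \<in> U}"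
      by (rule openin_pointwise_nbhd[OF W gW]) (rule that)
    \<comment> \<open>Each subbasic set around \<open>g\<close> meets \<open>A\<close>, possibly in
      different functions; irreducibility then yields one function in all of them.\<close>
    have "openin ?C S \<and> A \<inter> S \<noteq> {}" if S: "S \<in> \<F>" for S
    proof -
      obtain x U where S': "x \<in> topspace X" "openin Y U" "S = {f \<in> cont_maps X Y. f x \<in> U}"
        using \<F>(4)[OF S] by blast
      then have "g x \<in> U"
        using \<F>(2) S by blast
      then obtain f where "f \<in> A" "f x \<in> U"
        using mem[OF S'(1,2)] by blast
      then show ?thesis
        using S' AC openin_pointwise_subbasic[OF S'(1,2)] by auto
    qed
    then have "A \<inter> \<Inter>\<F> \<noteq> {}"
      by (intro irreducible_in_meets_Inter[OF A \<F>(1)])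
    then show "A \<inter> W \<noteq> {}"
      using AC \<F>(3) by blast
  next
    assume "A \<inter> W \<noteq> {}"
    then obtain f where f: "f \<in> A" "f \<in> W"
      by blast
    obtain \<F> where \<F>: "f \<in> \<Inter>\<F>" "cont_maps X Y \<inter> \<Inter>\<F> \<subseteq> W"
      "\<And>S. S \<in> \<F> \<Longrightarrow> \<exists>x U. x \<in> topspace X \<and> openin Y U \<and> S = {f \<in> cont_maps X Y. f x \<in> U}"
      by (rule openin_pointwise_nbhd[OF W f(2)]) (rule that)
    \<comment> \<open>Every subbasic set containing \<open>f\<close> contains \<open>g\<close>, so a
      basic neighbourhood of \<open>f\<close> inside \<open>W\<close> contains \<open>g\<close>
      too.\<close>
    have "g \<in> S" if S: "S \<in> \<F>" for S
    proof -
      obtain x U where S': "x \<in> topspace X" "openin Y U" "S = {f \<in> cont_maps X Y. f x \<in> U}"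
        using \<F>(3)[OF S] by blast
      then have "f x \<in> U"
        using \<F>(1) S by blast
      then have "g x \<in> U"
        using mem[OF S'(1,2)] f(1) by blast
      then show ?thesis
        using S'(3) gC by simp
    qed
    then show "g \<in> W"
      using gC \<F>(2) by blast
  qed
  then show ?thesis
    using gC by (auto simp: generic_point_def)
qed

text \<open>In a counterexample, let \<open>A\<close> be the complement of a maximal open set
  \<open>V\<close> as in \<open>Rudin_maximal_open\<close>. A generic point of \<open>A\<close> lies
  in every \<open>K\<close>, hence in \<open>V\<close>; but a generic point of \<open>A\<close>
  cannot lie in an open set disjoint from \<open>A\<close>.\<close>

lemma well_filtered_space_pointwise:
  assumes Y: "well_filtered_space Y"
  shows "well_filtered_space (pointwise_topology X Y)"
proof -
  let ?C = "pointwise_topology X Y"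
  have "\<exists>K\<in>\<K>. K \<subseteq> U"
    if U: "openin ?C U"
      and K: "\<And>K. K \<in> \<K> \<Longrightarrow> K \<noteq> {} \<and> compactin ?C K \<and> spec_upper ?C K"
      and filt: "filtered_family \<K>" and sub: "\<Inter>\<K> \<subseteq> U" for U \<K>
  proof (rule ccontr)
    assume "\<not> (\<exists>K\<in>\<K>. K \<subseteq> U)"
    then obtain V where V: "openin ?C V" "U \<subseteq> V" "\<And>K. K \<in> \<K> \<Longrightarrow> \<not> K \<subseteq> V"
      "\<And>W. openin ?C W \<Longrightarrow> V \<subset> W \<Longrightarrow> \<exists>K\<in>\<K>. K \<subseteq> W"
      using Rudin_maximal_open[OF U, of \<K>] K by metis
    define A where "A = topspace ?C - V"
    have A: "closedin ?C A"
      unfolding A_def by (intro closedin_diff closedin_topspace V(1))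
    have meets: "K \<inter> A \<noteq> {}" if "K \<in> \<K>" for K
      using K[OF that] V(3)[OF that] compactin_subset_topspace unfolding A_def by blast
    \<comment> \<open>Maximality of \<open>V\<close>, seen from \<open>A\<close>: enlarging
      \<open>V\<close> by an open set that meets \<open>A\<close> captures some
      \<open>K\<close>.\<close>
    have max: "\<exists>K\<in>\<K>. K \<inter> A \<subseteq> W" if W: "openin ?C W" "A \<inter> W \<noteq> {}" for W
    proof -
      have "openin ?C (V \<union> W)" "V \<subset> V \<union> W"
        using V(1) W by (auto simp: A_def)
      then obtain K where "K \<in> \<K>" "K \<subseteq> V \<union> W"
        using V(4) by blast
      then show ?thesis
        by (auto simp: A_def)
    qed
    have AC: "A \<subseteq> topspace ?C"
      by (auto simp: A_def)
    \<comment> \<open>Two open sets meeting \<open>A\<close> contain traces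
      \<open>K1 \<inter> A\<close> and \<open>K2 \<inter> A\<close>; a smaller member
      \<open>K3\<close> still meets \<open>A\<close>, so both open sets meet \<open>A\<close> in a
      common point.\<close>
    have irr: "irreducible_in ?C A"
      unfolding irreducible_in_iff_open
    proof (intro conjI allI impI)
      show "A \<noteq> {}"
        using meets filt unfolding filtered_family_def by blast
      fix W1 W2
      assume "openin ?C W1 \<and> openin ?C W2 \<and> A \<inter> W1 \<noteq> {} \<and> A \<inter> W2 \<noteq> {}"
      then obtain K1 K2 where "K1 \<in> \<K>" "K2 \<in> \<K>" "K1 \<inter> A \<subseteq> W1" "K2 \<inter> A \<subseteq> W2"
        using max by metis
      moreover from this obtain K3 where "K3 \<in> \<K>" "K3 \<subseteq> K1 \<inter> K2"
        using filt unfolding filtered_family_def by blast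
      ultimately show "A \<inter> (W1 \<inter> W2) \<noteq> {}"
        using meets by blast
    qed (fact AC)
    have "\<exists>y. generic_point Y ((\<lambda>f. f x) ` A) y" if x: "x \<in> topspace X" for x
    proof -
      let ?B = "(\<lambda>f. f x) ` A" and ?S = "\<lambda>K. (\<lambda>f. f x) ` (K \<inter> A)"
      note ev = continuous_map_pointwise_eval[OF x, of Y]
      have BY: "?B \<subseteq> topspace Y"
        using AC ev by (auto simp: continuous_map_def)
      \<comment> \<open>Otherwise well-filteredness of \<open>Y\<close> would place some nonempty
        \<open>?S K\<close> outside the closure of \<open>?B\<close>, although \<open>?S K\<close>
        is part of \<open>?B\<close>. This yields a point \<open>y\<close> common to the closure and
        all the saturations.\<close>
      have "\<not> (\<Inter>K\<in>\<K>. spec_up_closure Y (?S K)) \<subseteq> topspace Y - Y closure_of ?B"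
      proof
        assume *: "(\<Inter>K\<in>\<K>. spec_up_closure Y (?S K)) \<subseteq> topspace Y - Y closure_of ?B"
        have "\<exists>K\<in>\<K>. ?S K \<subseteq> topspace Y - Y closure_of ?B"
        proof (rule well_filtered_spaceD[OF Y _ filt _ _ *])
          show "compactin Y (?S K) \<and> ?S K \<noteq> {}" if "K \<in> \<K>" for K
            using K[OF that] meets[OF that] A ev
            by (auto intro!: image_compactin compact_Int_closedin)
        qed auto
        then show False
          using meets closure_of_subset[OF BY] by blast
      qed
      moreover have "(\<Inter>K\<in>\<K>. spec_up_closure Y (?S K)) \<subseteq> topspace Y"
        using filt spec_up_closure_subset_topspace unfolding filtered_family_def by fast
      ultimately obtain y where y: "\<And>K. K \<in> \<K> \<Longrightarrow> y \<in> spec_up_closure Y (?S K)"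
        "y \<in> Y closure_of ?B"
        by blast
      \<comment> \<open>By \<open>max\<close>, an open \<open>W\<close> meeting \<open>?B\<close>
        contains some \<open>?S K\<close>, hence its saturation, which contains \<open>y\<close>.
        The converse half of genericity is that \<open>y\<close> lies in the closure of
        \<open>?B\<close>.\<close>
      have "?B \<inter> W \<noteq> {} \<Longrightarrow> y \<in> W" if W: "openin Y W" for W
      proof -
        assume "?B \<inter> W \<noteq> {}"
        then have "A \<inter> {f \<in> cont_maps X Y. f x \<in> W} \<noteq> {}"
          using AC by auto
        then obtain K where "K \<in> \<K>" "K \<inter> A \<subseteq> {f \<in> cont_maps X Y. f x \<in> W}"
          using max[OF openin_pointwise_subbasic[OF x W]] by meson
        then have "spec_up_closure Y (?S K) \<subseteq> W"
          by (intro spec_up_closure_subset_open[OF W]) auto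
        then show "y \<in> W"
          using y(1) \<open>K \<in> \<K>\<close> by blast
      qed
      then have "generic_point Y ?B y"
        using y(2) unfolding generic_point_def in_closure_of by (metis disjoint_iff)
      then show ?thesis ..
    qed
    then obtain g where g: "generic_point ?C A g"
      using generic_point_pointwise[OF irr] by blast
    \<comment> \<open>A generic point of \<open>A\<close> lies above every member of
      \<open>A\<close>, and \<open>K\<close> is an upper set that meets \<open>A\<close>.\<close>
    have "g \<in> K" if "K \<in> \<K>" for K
    proof -
      obtain f where f: "f \<in> K" "f \<in> A"
        using meets \<open>K \<in> \<K>\<close> by blast
      then have "spec_le ?C f g"
        using g AC unfolding generic_point_def spec_le_iff by blast
      then show "g \<in> K"
        using f K[OF that] unfolding spec_upper_def by blast
    qed
    then have "g \<in> V"
      using sub V(2) by blast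
    then show False
      using g V(1) by (auto simp: generic_point_def A_def)
  qed
  moreover have "t0_space ?C"
    using Y by (simp add: t0_space_pointwise well_filtered_space_def)
  ultimately show ?thesis
    unfolding well_filtered_space_def filtered_family_def by (metis (no_types, lifting))
qed

section \<open>Retracts\<close>

lemma retract_generic_point:
  assumes "continuous_map X Y i" "continuous_map Y X r"
    and ri: "\<And>x. x \<in> topspace X \<Longrightarrow> r (i x) = x"
    and A: "A \<subseteq> topspace X" "generic_point Y (i ` A) s"
  shows "generic_point X A (r s)"
proof -
  have "i ` A \<subseteq> topspace Y"
    using assms(1) A(1) by (auto simp: continuous_map_def)
  then have "generic_point X (r ` i ` A) (r s)"
    using assms by (intro generic_point_image)
  moreover have "r ` i ` A = A"
    using A(1) ri by (force simp: image_iff)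
  ultimately show ?thesis
    by simp
qed

text \<open>The family is pushed forward along \<open>i\<close> and tested against the preimage of
  \<open>U\<close> under \<open>r\<close>.\<close>

lemma retract_well_filtered_space:
  assumes i: "continuous_map X Y i" and r: "continuous_map Y X r"
    and ri: "\<And>x. x \<in> topspace X \<Longrightarrow> r (i x) = x"
    and X: "t0_space X" and Y: "well_filtered_space Y"
  shows "well_filtered_space X"
proof -
  have "\<exists>K\<in>\<K>. K \<subseteq> U"
    if U: "openin X U"
      and K: "\<And>K. K \<in> \<K> \<Longrightarrow> K \<noteq> {} \<and> compactin X K \<and> spec_upper X K"
      and filt: "filtered_family \<K>" and sub: "\<Inter>\<K> \<subseteq> U" for U \<K>
  proof -
    let ?V = "{y \<in> topspace Y. r y \<in> U}"
    have rK: "r y \<in> K" if y: "y \<in> spec_up_closure Y (i ` K)" "K \<in> \<K>" for y K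
    proof -
      obtain x where x: "x \<in> K" "spec_le Y (i x) y"
        using y(1) unfolding spec_up_closure_def by blast
      moreover have "r (i x) = x"
        using K[OF y(2)] x(1) by (intro ri) (auto simp: spec_upper_def)
      ultimately show ?thesis
        using spec_le_image[OF r x(2)] K[OF y(2)] by (auto simp: spec_upper_def)
    qed
    have *: "(\<Inter>K\<in>\<K>. spec_up_closure Y (i ` K)) \<subseteq> ?V"
    proof
      fix y assume y: "y \<in> (\<Inter>K\<in>\<K>. spec_up_closure Y (i ` K))"
      then have "r y \<in> \<Inter>\<K>"
        using rK by auto
      moreover have "y \<in> topspace Y"
        using y filt spec_up_closure_subset_topspace unfolding filtered_family_def by fast
      ultimately show "y \<in> ?V"
        using sub by auto
    qed
    have "\<exists>K\<in>\<K>. i ` K \<subseteq> ?V"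
    proof (rule well_filtered_spaceD[OF Y _ filt _ _ *])
      show "openin Y ?V"
        using r U by (rule openin_continuous_map_preimage)
      show "compactin Y (i ` K) \<and> i ` K \<noteq> {}" if "K \<in> \<K>" for K
        using K[OF that] i by (auto intro: image_compactin)
    qed auto
    then obtain K' where K': "K' \<in> \<K>" "i ` K' \<subseteq> ?V"
      by blast
    have "x \<in> U" if "x \<in> K'" for x
    proof -
      have "x \<in> topspace X"
        using K[OF K'(1)] that by (auto simp: spec_upper_def)
      then show ?thesis
        using ri[of x] K'(2) that by auto
    qed
    then show ?thesis
      using K'(1) by blast
  qed
  then show ?thesis
    using X unfolding well_filtered_space_def filtered_family_def by (metis (no_types, lifting))
qed

section \<open>The three equivalences\<close>

theorem corollary4p14:
  fixes X :: "'a topology" and Y :: "'b topology"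
  assumes "t0_space X" and "t0_space Y" and "topspace X \<noteq> {}"
  shows "(sober_space Y \<longleftrightarrow> sober_space (pointwise_topology X Y)) \<and>
         (d_space Y \<longleftrightarrow> d_space (pointwise_topology X Y)) \<and>
         (well_filtered_space Y \<longleftrightarrow> well_filtered_space (pointwise_topology X Y))"
proof -
  let ?C = "pointwise_topology X Y"
  \<comment> \<open>A point of \<open>X\<close> provides the evaluation that undoes the formation of
    constant maps.\<close>
  obtain a where a: "a \<in> topspace X"
    using assms(3) by blast
  define i where "i = (\<lambda>y::'b. restrict (\<lambda>x. y) (topspace X))"
  define r where "r = (\<lambda>f::'a \<Rightarrow> 'b. f a)"
  have i: "continuous_map Y ?C i" and r: "continuous_map ?C Y r"
    and ri: "\<And>y. y \<in> topspace Y \<Longrightarrow> r (i y) = y"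
    using a by (simp_all add: i_def r_def continuous_map_pointwise_const
        continuous_map_pointwise_eval)
  note C0 = t0_space_pointwise[OF assms(2), of X]
  have "sober_space Y \<longleftrightarrow> sober_space ?C"
    unfolding sober_space_iff_generic_point[OF assms(2)] sober_space_iff_generic_point[OF C0]
  proof (intro iffI allI impI)
    fix A assume "\<forall>B. irreducible_in Y B \<longrightarrow> (\<exists>s. generic_point Y B s)" "irreducible_in ?C A"
    then show "\<exists>g. generic_point ?C A g"
      by (metis generic_point_pointwise irreducible_in_image continuous_map_pointwise_eval)
  next
    fix B assume "\<forall>A. irreducible_in ?C A \<longrightarrow> (\<exists>g. generic_point ?C A g)"
      and B: "irreducible_in Y B"
    then obtain g where "generic_point ?C (i ` B) g"
      using irreducible_in_image[OF i] by blast
    then have "generic_point Y B (r g)"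
      using B by (intro retract_generic_point[OF i r] ri) (auto simp: irreducible_in_def)
    then show "\<exists>s. generic_point Y B s" ..
  qed
  moreover have "d_space Y \<longleftrightarrow> d_space ?C"
    unfolding d_space_iff_generic_point[OF assms(2)] d_space_iff_generic_point[OF C0]
  proof (intro iffI allI impI)
    fix D assume "\<forall>B. spec_directed Y B \<longrightarrow> (\<exists>s. generic_point Y B s)" "spec_directed ?C D"
    \<comment> \<open>Directedness is used twice: it passes to the evaluations, giving their generic
      points in \<open>Y\<close>, and it makes \<open>D\<close> irreducible.\<close>
    then show "\<exists>g. generic_point ?C D g"
      by (metis generic_point_pointwise spec_directed_imp_irreducible spec_directed_image
          continuous_map_pointwise_eval)
  next
    fix B assume "\<forall>D. spec_directed ?C D \<longrightarrow> (\<exists>g. generic_point ?C D g)"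
      and B: "spec_directed Y B"
    then obtain g where "generic_point ?C (i ` B) g"
      using spec_directed_image[OF i] by blast
    then have "generic_point Y B (r g)"
      using B by (intro retract_generic_point[OF i r] ri) (auto simp: spec_directed_def)
    then show "\<exists>s. generic_point Y B s" ..
  qed
  moreover have "well_filtered_space Y \<longleftrightarrow> well_filtered_space ?C"
    using well_filtered_space_pointwise retract_well_filtered_space[OF i r _ assms(2)] ri by blast
  ultimately show ?thesis
    by blast
qed

end
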